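(* Let $K$ and $L$ be two origin-symmetric star bodies in $\mathbb{R}^n$ such that $(\mathbb{R}^n,\|\cdot\|_K)$ embeds in $L_0$ and $$\Gamma^*_0K\subset\Gamma^*_0L .$$ Then $\mathrm{vol}(L)\le\mathrm{vol}(K)$.
   Context: An origin-symmetric star body $K$ is a compact origin-symmetric set, star-shaped with respect to the origin, whose Minkowski functional $\|x\|_K=\min\{a\ge0:x\in aK\}$ is continuous and positive away from the origin. $\mathrm{vol}$ denotes $n$-dimensional Lebesgue measure, and $(x,\xi)$ is the standard inner product. Polar $0$-centroid body: $\Gamma^*_0K=\{\xi:\|\xi\|_{\Gamma^*_0K}\le1\}$ is the body with Minkowski functional $$\|\xi\|_{\Gamma^*_0K}=\exp\left(\frac{1}{\mathrm{vol}(K)}\int_K\ln|(x,\xi)|\,dx\right),\quad \xi\in\mathbb{R}^n\setminus\{0\}.$$ Thus $\Gamma^*_0K\subset\Gamma^*_0L$ means that $\frac{1}{\mathrm{vol}(L)}\int_L\ln|(x,\xi)|\,dx\le\frac{1}{\mathrm{vol}(K)}\int_K\ln|(x,\xi)|\,dx$ for every $\xi\in S^{n-1}$. Embedding in $L_0$: the space $(\mathbb{R}^n,\|\cdot\|)$ embeds in $L_0$ if there exist a finite (non-negative) Borel measure $\mu$ on the unit sphere $S^{n-1}$ and a constant $C\in\mathbb{R}$ such that for every $x\in\mathbb{R}^n\setminus\{0\}$, $\ln\|x\|=\int_{S^{n-1}}\ln|(x,\xi)|\,d\mu(\xi)+C$. *)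

theory Defs
  imports "HOL-Analysis.Analysis"
begin

text \<open>The minimum is rendered by \<open>LEAST\<close>, so this is meaningful only where the minimum exists;
  compactness and the absorption clause of \<open>symmetric_star_body\<close> below guarantee that.\<close>

definition minkowski_functional :: "'a::real_vector set \<Rightarrow> 'a \<Rightarrow> real" where
  "minkowski_functional K x = (LEAST a. 0 \<le> a \<and> x \<in> (\<lambda>y. a *\<^sub>R y) ` K)"

text \<open>The clause \<open>\<forall>x. \<exists>a\<ge>0. x \<in> a K\<close> says that the Minkowski functional is finite everywhere;
  without it the total function above would take an arbitrary value where no such \<open>a\<close> exists.\<close>

definition symmetric_star_body :: "'a::euclidean_space set \<Rightarrow> bool" where
  "symmetric_star_body K \<longleftrightarrow>
     compact K \<and>
     (\<forall>x\<in>K. - x \<in> K) \<and>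
     0 \<in> K \<and> (\<forall>x\<in>K. closed_segment 0 x \<subseteq> K) \<and>
     (\<forall>x. \<exists>a\<ge>0. x \<in> (\<lambda>y. a *\<^sub>R y) ` K) \<and>
     continuous_on (- {0}) (minkowski_functional K) \<and>
     (\<forall>x. x \<noteq> 0 \<longrightarrow> 0 < minkowski_functional K x)"

abbreviation vol :: "'a::euclidean_space set \<Rightarrow> real" where
  "vol K \<equiv> measure lborel K"

text \<open>The integrand is \<open>-\<infinity>\<close> on the hyperplane orthogonal to \<open>\<xi>\<close>, where HOL has \<open>ln 0 = 0\<close>;
  for \<open>\<xi> \<noteq> 0\<close> this is a Lebesgue null set.\<close>

definition polar_0_centroid_norm :: "'a::euclidean_space set \<Rightarrow> 'a \<Rightarrow> real" where
  "polar_0_centroid_norm K \<xi> =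
     (if \<xi> = 0 then 0
      else exp (1 / vol K * (LINT x:K|lborel. ln \<bar>x \<bullet> \<xi>\<bar>)))"

definition polar_0_centroid_body :: "'a::euclidean_space set \<Rightarrow> 'a set" where
  "polar_0_centroid_body K = {\<xi>. polar_0_centroid_norm K \<xi> \<le> 1}"

text \<open>The integral of \<open>ln \<bar>x \<bullet> \<xi>\<bar>\<close>, whose value may be \<open>-\<infinity>\<close>, equals the real number
  \<open>ln (N x) - C\<close>, so it must be finite. As HOL has \<open>ln 0 = 0\<close> and gives non-integrable functions
  the integral \<open>0\<close>, finiteness is spelled out: the hyperplane orthogonal to \<open>x\<close>, where the
  integrand is \<open>-\<infinity>\<close>, is a \<open>\<mu>\<close>-null set, and the integrand is \<open>\<mu>\<close>-integrable.\<close>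

definition embeds_in_L0 :: "('a::euclidean_space \<Rightarrow> real) \<Rightarrow> bool" where
  "embeds_in_L0 N \<longleftrightarrow>
     (\<exists>(\<mu> :: 'a measure) (C :: real).
        finite_measure \<mu> \<and>
        sets \<mu> = sets (restrict_space borel (sphere 0 1)) \<and>
        (\<forall>x. x \<noteq> 0 \<longrightarrow>
           (AE \<xi> in \<mu>. x \<bullet> \<xi> \<noteq> 0) \<and>
           integrable \<mu> (\<lambda>\<xi>. ln \<bar>x \<bullet> \<xi>\<bar>) \<and>
           ln (N x) = (LINT \<xi>|\<mu>. ln \<bar>x \<bullet> \<xi>\<bar>) + C))"

end

theory Submission
  imports Defs
begin

text \<open>Integrating the inequality given by the inclusion of the polar bodies against the measure
  that represents \<open>ln \<parallel>x\<parallel>\<^sub>K\<close>, Fubini shows that the average of \<open>ln \<parallel>x\<parallel>\<^sub>K\<close> over \<open>L\<close> is at most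
  its average over \<open>K\<close>. Among sets of given volume, the dilate \<open>t K\<close> minimises the integral of
  \<open>ln \<parallel>x\<parallel>\<^sub>K\<close>, and the average over \<open>t K\<close> is \<open>ln t\<close> plus the average over \<open>K\<close>. Choosing \<open>t\<close> with
  \<open>vol (t K) = vol L\<close> gives \<open>ln t \<le> 0\<close>.\<close>

section \<open>Dilations, null hyperplanes and a counting bound for the logarithm\<close>

lemma lborel_scaleR:
  assumes "0 < t"
  shows "(lborel :: 'a::euclidean_space measure)
    = density (distr lborel borel (\<lambda>x. t *\<^sub>R x)) (\<lambda>_. ennreal (t ^ DIM('a)))"
  using lborel_affine[of t "0::'a"] assms by simp

lemma nn_integral_lborel_scaleR:
  fixes f :: "'a::euclidean_space \<Rightarrow> ennreal"
  assumes [measurable]: "f \<in> borel_measurable borel" and "0 < t"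
  shows "(\<integral>\<^sup>+x. f x \<partial>lborel) = ennreal (t ^ DIM('a)) * (\<integral>\<^sup>+x. f (t *\<^sub>R x) \<partial>lborel)"
  by (subst lborel_scaleR[OF \<open>0 < t\<close>])
    (simp add: nn_integral_density nn_integral_distr nn_integral_cmult)

lemma integral_lborel_scaleR:
  fixes f :: "'a::euclidean_space \<Rightarrow> real"
  assumes [measurable]: "f \<in> borel_measurable borel" and "0 < t"
  shows "(\<integral>x. f x \<partial>lborel) = t ^ DIM('a) * (\<integral>x. f (t *\<^sub>R x) \<partial>lborel)"
  by (subst lborel_scaleR[OF \<open>0 < t\<close>], subst integral_density)
    (use \<open>0 < t\<close> in \<open>simp_all add: integral_distr\<close>)

text \<open>Removes the hyperplane on which the convention \<open>ln 0 = 0\<close> would break the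
  rule \<open>ln (s * u) = ln s + ln u\<close> for
  \<open>u = \<bar>x \<bullet> \<xi>\<bar>\<close>.\<close>

lemma AE_lborel_inner_nonzero:
  fixes \<xi> :: "'a::euclidean_space"
  assumes "\<xi> \<noteq> 0"
  shows "AE x in lborel. x \<bullet> \<xi> \<noteq> 0"
proof -
  have "negligible {x. \<xi> \<bullet> x = 0}"
    using assms by (intro negligible_hyperplane) auto
  moreover have "{x. \<xi> \<bullet> x = 0} \<in> sets borel" by measurable
  ultimately have "{x. \<xi> \<bullet> x = 0} \<in> null_sets lborel"
    by (simp add: negligible_iff_null_sets null_sets_completion_iff)
  then show ?thesis
    by (auto dest!: AE_not_in simp: inner_commute)
qed

text \<open>A discrete layer-cake bound: the sum counts the m with m \<le> -ln s, and for s \<le> 1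
  there are floor(-ln s) + 1 of them. For s > 1 the left side is truncated to 0 by
  \<open>ennreal\<close>.\<close>

lemma neg_ln_le_suminf_indicator:
  assumes "0 < s"
  shows "ennreal (- ln s) \<le> (\<Sum>m. indicator {..exp (- real m)} s)"
proof (cases "s \<le> 1")
  case True
  \<comment> \<open>The index m = 0 is counted too, so \<open>Suc k\<close> terms equal 1; this
    makes up for rounding down.\<close>
  define k where "k = nat \<lfloor>- ln s\<rfloor>"
  have "ln s \<le> 0" using assms True by simp
  then have k: "real k \<le> - ln s" "- ln s \<le> real (Suc k)"
    unfolding k_def by linarith+
  have "s \<le> exp (- real m)" if "m < Suc k" for m
    using that k(1) assms by (subst ln_le_cancel_iff[symmetric]) auto
  then have "ennreal (real (Suc k)) = (\<Sum>m<Suc k. indicator {..exp (- real m)} s)"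
    by (simp add: ennreal_of_nat_eq_real_of_nat[symmetric] del: sum.lessThan_Suc)
  also have "\<dots> \<le> (\<Sum>m. indicator {..exp (- real m)} s)"
    by (intro sum_le_suminf) auto
  finally show ?thesis
    using k(2) by (meson ennreal_leI order_trans)
qed (simp add: ennreal_neg)

section \<open>Integrals of the logarithm of a positively homogeneous function\<close>

locale gauge_function =
  fixes N :: "'a::euclidean_space \<Rightarrow> real"
  assumes measurable_gauge [measurable]: "N \<in> borel_measurable borel"
    and scale: "0 < t \<Longrightarrow> N (t *\<^sub>R x) = t * N x"
    and pos: "x \<noteq> 0 \<Longrightarrow> 0 < N x"
    and emeasure_finite: "emeasure lborel {x. N x \<le> 1} < \<infinity>"
begin

text \<open>When \<open>N\<close> is the Minkowski functional of a star body \<open>K\<close> and t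
  > 0, this is the dilate tK.\<close>

definition sublevel :: "real \<Rightarrow> 'a set" where
  "sublevel t = {x. N x \<le> t}"

lemma sublevel_borel [measurable]: "sublevel t \<in> sets borel"
  unfolding sublevel_def by measurable

lemma indicator_sublevel_scaleR:
  assumes "0 < t"
  shows "indicator (sublevel t) (t *\<^sub>R x) = indicator (sublevel 1) x"
  using assms by (auto simp: sublevel_def scale indicator_def)

lemma emeasure_sublevel:
  assumes "0 < t"
  shows "emeasure lborel (sublevel t) = ennreal (t ^ DIM('a)) * emeasure lborel (sublevel 1)"
proof -
  have "emeasure lborel (sublevel t) = (\<integral>\<^sup>+x. indicator (sublevel t) x \<partial>lborel)"
    by simp
  also have "\<dots> = ennreal (t ^ DIM('a)) * (\<integral>\<^sup>+x. indicator (sublevel t) (t *\<^sub>R x) \<partial>lborel)"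
    using assms by (intro nn_integral_lborel_scaleR) auto
  finally show ?thesis
    using assms by (simp add: indicator_sublevel_scaleR)
qed

lemma emeasure_sublevel_finite:
  assumes "0 < t"
  shows "emeasure lborel (sublevel t) < \<infinity>"
  using emeasure_finite unfolding emeasure_sublevel[OF assms]
  by (simp add: ennreal_mult_less_top sublevel_def)

lemma measure_sublevel:
  assumes "0 < t"
  shows "measure lborel (sublevel t) = t ^ DIM('a) * measure lborel (sublevel 1)"
  using assms by (simp add: measure_def emeasure_sublevel[OF assms] enn2real_mult)

text \<open>On the unit sublevel set the modulus of \<open>ln (N x)\<close> is
  \<open>- ln (N x)\<close>, large only near the origin. The counting bound turns its integral into
  the sum of the volumes of the sublevel sets at exp(-m), a geometric series of ratio exp(-n) in
  dimension n.\<close>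

lemma integrable_ln_sublevel_1: "integrable lborel (\<lambda>x. indicator (sublevel 1) x * ln (N x))"
proof (rule integrableI_bounded)
  let ?c = "measure lborel (sublevel 1)"
  have "(\<integral>\<^sup>+x. ennreal (norm (indicator (sublevel 1) x * ln (N x))) \<partial>lborel)
      \<le> (\<integral>\<^sup>+x. (\<Sum>m. indicator (sublevel (exp (- real m))) x) \<partial>lborel)"
  proof (rule nn_integral_mono_AE)
    show "AE x in lborel. ennreal (norm (indicator (sublevel 1) x * ln (N x)))
        \<le> (\<Sum>m. indicator (sublevel (exp (- real m))) x)"
      using AE_lborel_singleton[of 0]
    proof eventually_elim
      case (elim x)
      have "0 < N x" using pos elim by simp
      then have "ennreal (norm (indicator (sublevel 1) x * ln (N x))) \<le> ennreal (- ln (N x))"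
        by (auto simp: indicator_def sublevel_def)
      also have "\<dots> \<le> (\<Sum>m. indicator {..exp (- real m)} (N x))"
        using \<open>0 < N x\<close> by (rule neg_ln_le_suminf_indicator)
      finally show ?case
        by (simp add: indicator_def sublevel_def)
    qed
  qed
  also have "\<dots> = (\<Sum>m. emeasure lborel (sublevel (exp (- real m))))"
    by (subst nn_integral_suminf) auto
  also have "\<dots> = (\<Sum>m. ennreal (exp (- real DIM('a)) ^ m * ?c))"
  proof (rule suminf_cong)
    fix m
    have "exp (- real m) ^ DIM('a) = exp (- real DIM('a)) ^ m"
      by (simp add: exp_of_nat_mult[symmetric] mult.commute)
    moreover have "emeasure lborel (sublevel 1) = ennreal ?c"
      using emeasure_sublevel_finite[of 1] by (intro emeasure_eq_ennreal_measure) auto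
    ultimately show "emeasure lborel (sublevel (exp (- real m)))
        = ennreal (exp (- real DIM('a)) ^ m * ?c)"
      by (simp add: emeasure_sublevel[of "exp (- real m)"] ennreal_mult)
  qed
  also have "\<dots> < \<infinity>"
  proof -
    have "summable (\<lambda>m. exp (- real DIM('a)) ^ m * ?c)"
      by (intro summable_mult2 summable_geometric) simp
    then show ?thesis
      by (subst suminf_ennreal2) auto
  qed
  finally show "(\<integral>\<^sup>+x. ennreal (norm (indicator (sublevel 1) x * ln (N x))) \<partial>lborel) < \<infinity>" .
qed auto

lemma integrable_indicator_finite:
  assumes "A \<in> sets borel" "emeasure lborel A < \<infinity>"
  shows "integrable lborel (\<lambda>x. indicator A x * c :: real)"
  using assms by (intro integrable_mult_left integrable_real_indicator) auto

text \<open>The origin has to be left out: homogeneity forces \<open>N 0 = 0\<close>, and with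
  \<open>ln 0 = 0\<close> the two sides there are 0 and \<open>ln t\<close>.\<close>

lemma AE_ln_scaleR:
  assumes "0 < t"
  shows "AE x in lborel. indicator (sublevel t) (t *\<^sub>R x) * ln (N (t *\<^sub>R x))
    = indicator (sublevel 1) x * ln (N x) + indicator (sublevel 1) x * ln t"
  using AE_lborel_singleton[of 0]
proof eventually_elim
  case (elim x)
  then show ?case
    using assms pos[of x]
    by (simp add: indicator_sublevel_scaleR scale ln_mult algebra_simps)
qed

lemma integrable_ln_sublevel:
  assumes "0 < t"
  shows "integrable lborel (\<lambda>x. indicator (sublevel t) x * ln (N x))"
proof (rule integrableI_bounded)
  let ?g = "\<lambda>x. indicator (sublevel 1) x * ln (N x) + indicator (sublevel 1) x * ln t"
  have g: "integrable lborel ?g"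
    using emeasure_sublevel_finite[of 1]
    by (intro Bochner_Integration.integrable_add integrable_ln_sublevel_1 integrable_indicator_finite) auto
  have "(\<integral>\<^sup>+x. ennreal (norm (indicator (sublevel t) x * ln (N x))) \<partial>lborel)
      = ennreal (t ^ DIM('a))
        * (\<integral>\<^sup>+x. ennreal (norm (indicator (sublevel t) (t *\<^sub>R x) * ln (N (t *\<^sub>R x)))) \<partial>lborel)"
    using assms by (intro nn_integral_lborel_scaleR) auto
  also have "(\<integral>\<^sup>+x. ennreal (norm (indicator (sublevel t) (t *\<^sub>R x) * ln (N (t *\<^sub>R x)))) \<partial>lborel)
      = (\<integral>\<^sup>+x. ennreal (norm (?g x)) \<partial>lborel)"
    using AE_ln_scaleR[OF assms] by (intro nn_integral_cong_AE) auto
  also have "ennreal (t ^ DIM('a)) * \<dots> < \<infinity>"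
    using g by (simp add: integrable_iff_bounded ennreal_mult_less_top)
  finally show "(\<integral>\<^sup>+x. ennreal (norm (indicator (sublevel t) x * ln (N x))) \<partial>lborel) < \<infinity>" .
qed auto

text \<open>Substitute x = t y. After division by the volume of \<open>sublevel t\<close>, when that
  is positive, this says that passing to the dilate adds \<open>ln t\<close> to the average of
  \<open>ln N\<close>.\<close>

lemma integral_ln_sublevel:
  assumes "0 < t"
  shows "(\<integral>x. indicator (sublevel t) x * ln (N x) \<partial>lborel)
    = t ^ DIM('a) * ((\<integral>x. indicator (sublevel 1) x * ln (N x) \<partial>lborel)
        + measure lborel (sublevel 1) * ln t)"
proof -
  have "(\<integral>x. indicator (sublevel t) x * ln (N x) \<partial>lborel)
      = t ^ DIM('a) * (\<integral>x. indicator (sublevel t) (t *\<^sub>R x) * ln (N (t *\<^sub>R x)) \<partial>lborel)"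
    using assms by (intro integral_lborel_scaleR) auto
  also have "(\<integral>x. indicator (sublevel t) (t *\<^sub>R x) * ln (N (t *\<^sub>R x)) \<partial>lborel)
      = (\<integral>x. indicator (sublevel 1) x * ln (N x) + indicator (sublevel 1) x * ln t \<partial>lborel)"
    using AE_ln_scaleR[OF assms] by (intro integral_cong_AE) auto
  also have "\<dots> = (\<integral>x. indicator (sublevel 1) x * ln (N x) \<partial>lborel)
        + measure lborel (sublevel 1) * ln t"
    using emeasure_sublevel_finite[of 1]
    by (subst Bochner_Integration.integral_add)
      (auto intro!: integrable_ln_sublevel_1 integrable_indicator_finite)
  finally show ?thesis .
qed

lemma integrable_ln_subset:
  assumes "A \<in> sets borel" "A \<subseteq> sublevel t" "0 < t"
  shows "integrable lborel (\<lambda>x. indicator A x * ln (N x))"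
  using assms set_integrable_subset[of lborel "sublevel t" "\<lambda>x. ln (N x)" A] integrable_ln_sublevel
  by (simp add: set_integrable_def)

text \<open>The bathtub principle. With B the sublevel set, (1_A - 1_B)(ln N - ln t) is nonnegative
  off the origin, since N > t on A - B and N \<le> t on B - A. Equal volumes make the
  \<open>ln t\<close> terms cancel after integration.\<close>

lemma integral_ln_sublevel_le:
  assumes A [measurable]: "A \<in> sets borel" "integrable lborel (\<lambda>x. indicator A x * ln (N x))"
    and "emeasure lborel A < \<infinity>"
    and vol: "measure lborel A = measure lborel (sublevel t)" and "0 < t"
  shows "(\<integral>x. indicator (sublevel t) x * ln (N x) \<partial>lborel) \<le> (\<integral>x. indicator A x * ln (N x) \<partial>lborel)"
proof -
  let ?B = "sublevel t"
  note int = A(2) integrable_ln_sublevel[OF \<open>0 < t\<close>]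
    integrable_indicator_finite[OF A(1) assms(3), of "ln t"]
    integrable_indicator_finite[OF sublevel_borel emeasure_sublevel_finite[OF \<open>0 < t\<close>], of "ln t"]
  have "0 \<le> (\<integral>x. (indicator A x * ln (N x) - indicator ?B x * ln (N x))
      - (indicator A x * ln t - indicator ?B x * ln t) \<partial>lborel)"
  proof (rule integral_nonneg_AE)
    show "AE x in lborel. 0 \<le> (indicator A x * ln (N x) - indicator ?B x * ln (N x))
      - (indicator A x * ln t - indicator ?B x * ln t)"
      using AE_lborel_singleton[of 0]
    proof eventually_elim
      case (elim x)
      then show ?case
        using pos[of x] \<open>0 < t\<close> by (auto simp: indicator_def sublevel_def)
    qed
  qed
  also have "\<dots> = (\<integral>x. indicator A x * ln (N x) \<partial>lborel) - (\<integral>x. indicator ?B x * ln (N x) \<partial>lborel)"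
    using int vol by simp
  finally show ?thesis by simp
qed

end

section \<open>The Minkowski functional of a star body\<close>

context
  fixes K :: "'a::euclidean_space set"
  assumes K: "symmetric_star_body K"
begin

lemma star_body_closed: "closed K"
  using K by (auto simp: symmetric_star_body_def compact_imp_closed)

lemma star_body_scaleR_mem:
  assumes "x \<in> K" "0 \<le> u" "u \<le> 1"
  shows "u *\<^sub>R x \<in> K"
proof -
  have "u *\<^sub>R x \<in> closed_segment 0 x"
    using assms by (auto simp: closed_segment_def)
  then show ?thesis
    using K assms(1) unfolding symmetric_star_body_def by blast
qed

text \<open>Compactness of \<open>K\<close> gives the minimum. Pairs (a, y) with a y = x are used
  instead of the condition x / a \<in> K, so that a = 0 needs no separate treatment; the cap c makes
  the set of pairs compact.\<close>

lemma minkowski_functional_attained: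
  "\<exists>a. 0 \<le> a \<and> x \<in> (\<lambda>y. a *\<^sub>R y) ` K \<and> (\<forall>b. 0 \<le> b \<and> x \<in> (\<lambda>y. b *\<^sub>R y) ` K \<longrightarrow> a \<le> b)"
proof -
  obtain c where c: "0 \<le> c" "x \<in> (\<lambda>y. c *\<^sub>R y) ` K"
    using K unfolding symmetric_star_body_def by blast
  let ?P = "({0..c} \<times> K) \<inter> {p. fst p *\<^sub>R snd p = x}"
  have "closed {p::real \<times> 'a. fst p *\<^sub>R snd p = x}"
    by (intro closed_Collect_eq continuous_intros)
  then have "compact ?P"
    using K by (intro compact_Int_closed compact_Times) (auto simp: symmetric_star_body_def)
  moreover have "continuous_on ?P fst" by (intro continuous_intros)
  ultimately have "compact (fst ` ?P)" by (rule compact_continuous_image[rotated])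
  moreover have "c \<in> fst ` ?P" using c by force
  ultimately obtain a where a: "a \<in> fst ` ?P" "\<And>b. b \<in> fst ` ?P \<Longrightarrow> a \<le> b"
    using compact_attains_inf[of "fst ` ?P"] by blast
  show ?thesis
  proof (intro exI[of _ a] conjI allI impI)
    show "0 \<le> a" "x \<in> (\<lambda>y. a *\<^sub>R y) ` K" using a(1) by auto
    fix b assume b: "0 \<le> b \<and> x \<in> (\<lambda>y. b *\<^sub>R y) ` K"
    show "a \<le> b"
    proof (cases "b \<le> c")
      case True
      then have "b \<in> fst ` ?P" using b by force
      then show ?thesis by (rule a(2))
    next
      case False
      then show ?thesis using a(2)[OF \<open>c \<in> fst ` ?P\<close>] by simp
    qed
  qed
qed

lemma minkowski_functional_least:
  "0 \<le> minkowski_functional K x"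
  "x \<in> (\<lambda>y. minkowski_functional K x *\<^sub>R y) ` K"
  "0 \<le> b \<Longrightarrow> x \<in> (\<lambda>y. b *\<^sub>R y) ` K \<Longrightarrow> minkowski_functional K x \<le> b"
proof -
  obtain a where a: "0 \<le> a" "x \<in> (\<lambda>y. a *\<^sub>R y) ` K"
    "\<And>b. 0 \<le> b \<and> x \<in> (\<lambda>y. b *\<^sub>R y) ` K \<Longrightarrow> a \<le> b"
    using minkowski_functional_attained by blast
  then have "minkowski_functional K x = a"
    unfolding minkowski_functional_def by (intro Least_equality) auto
  then show "0 \<le> minkowski_functional K x" "x \<in> (\<lambda>y. minkowski_functional K x *\<^sub>R y) ` K"
    "0 \<le> b \<Longrightarrow> x \<in> (\<lambda>y. b *\<^sub>R y) ` K \<Longrightarrow> minkowski_functional K x \<le> b"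
    using a by auto
qed

lemma minkowski_functional_le_iff:
  assumes "0 < t"
  shows "minkowski_functional K x \<le> t \<longleftrightarrow> (1 / t) *\<^sub>R x \<in> K"
proof
  assume le: "minkowski_functional K x \<le> t"
  obtain y where y: "y \<in> K" "x = minkowski_functional K x *\<^sub>R y"
    using minkowski_functional_least(2)[of x] by blast
  \<comment> \<open>Star-shapedness enters here: the factor lies in [0, 1].\<close>
  have "(minkowski_functional K x / t) *\<^sub>R y \<in> K"
    using y(1) le assms minkowski_functional_least(1)[of x] by (intro star_body_scaleR_mem) auto
  moreover have "(1 / t) *\<^sub>R x = (minkowski_functional K x / t) *\<^sub>R y"
    by (subst y(2)) simp
  ultimately show "(1 / t) *\<^sub>R x \<in> K" by simp
next
  assume "(1 / t) *\<^sub>R x \<in> K"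
  then have "x \<in> (\<lambda>y. t *\<^sub>R y) ` K"
    using assms by (intro image_eqI[where x = "(1 / t) *\<^sub>R x"]) auto
  then show "minkowski_functional K x \<le> t"
    using assms by (intro minkowski_functional_least(3)) auto
qed

lemma minkowski_functional_scaleR:
  assumes "0 < t"
  shows "minkowski_functional K (t *\<^sub>R x) = t * minkowski_functional K x"
proof -
  have iff: "minkowski_functional K (t *\<^sub>R x) \<le> s \<longleftrightarrow> t * minkowski_functional K x \<le> s"
    if "0 < s" for s
    using minkowski_functional_le_iff[of s "t *\<^sub>R x"] minkowski_functional_le_iff[of "s / t" x]
      assms that
    by (simp add: field_simps)
  \<comment> \<open>Both sides have the same positive upper bounds. Either side may be 0, so a bound
    is made positive by adding \<open>e\<close>.\<close>
  show ?thesis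
  proof (rule antisym; rule field_le_epsilon)
    fix e :: real assume "0 < e"
    have "0 < t * minkowski_functional K x + e"
      using \<open>0 < e\<close> assms minkowski_functional_least(1)[of x] by (intro add_nonneg_pos) auto
    from iff[OF this] \<open>0 < e\<close>
    show "minkowski_functional K (t *\<^sub>R x) \<le> t * minkowski_functional K x + e" by simp
    have "0 < minkowski_functional K (t *\<^sub>R x) + e"
      using \<open>0 < e\<close> minkowski_functional_least(1)[of "t *\<^sub>R x"] by simp
    from iff[OF this] \<open>0 < e\<close>
    show "t * minkowski_functional K x \<le> minkowski_functional K (t *\<^sub>R x) + e" by simp
  qed
qed

lemma minkowski_functional_le_0_iff: "minkowski_functional K x \<le> 0 \<longleftrightarrow> x = 0"
proof
  show "minkowski_functional K x \<le> 0 \<Longrightarrow> x = 0"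
    using K unfolding symmetric_star_body_def by force
  have "(0::'a) \<in> (\<lambda>y. 0 *\<^sub>R y) ` K"
    using K by (auto simp: symmetric_star_body_def image_iff)
  then show "x = 0 \<Longrightarrow> minkowski_functional K x \<le> 0"
    using minkowski_functional_least(3)[of 0 0] by simp
qed

lemma star_body_eq_sublevel: "K = {x. minkowski_functional K x \<le> 1}"
  using minkowski_functional_le_iff[of 1] by auto

lemma gauge_function_star_body: "gauge_function (minkowski_functional K)"
proof
  \<comment> \<open>Every sublevel set is closed: a preimage of \<open>K\<close>, the origin alone,
    or empty. This handles the origin, which the continuity clause of
    \<open>symmetric_star_body\<close> leaves out.\<close>
  show "minkowski_functional K \<in> borel_measurable borel"
  proof (rule borel_measurableI_le)
    fix t :: real
    consider "0 < t" | "t = 0" | "t < 0" by linarith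
    then have "closed {x. minkowski_functional K x \<le> t}"
    proof cases
      case 1
      have "closed ((\<lambda>x. (1 / t) *\<^sub>R x) -` K)"
        by (intro closed_vimage star_body_closed continuous_intros)
      then show ?thesis
        using 1 by (simp add: minkowski_functional_le_iff vimage_def)
    next
      case 2
      then show ?thesis by (simp add: minkowski_functional_le_0_iff)
    next
      case 3
      then have "{x. minkowski_functional K x \<le> t} = {}"
        by (auto simp: not_le intro: less_le_trans[OF _ minkowski_functional_least(1)])
      then show ?thesis by (metis closed_empty)
    qed
    then show "{x \<in> space borel. minkowski_functional K x \<le> t} \<in> sets borel" by simp
  qed
  show "minkowski_functional K (t *\<^sub>R x) = t * minkowski_functional K x" if "0 < t" for t x
    using that by (rule minkowski_functional_scaleR)
  show "0 < minkowski_functional K x" if "x \<noteq> 0" for x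
    using K that unfolding symmetric_star_body_def by simp
  show "emeasure lborel {x. minkowski_functional K x \<le> 1} < \<infinity>"
    using K star_body_eq_sublevel
    by (metis emeasure_bounded_finite compact_imp_bounded symmetric_star_body_def)
qed

interpretation gauge_function "minkowski_functional K"
  by (rule gauge_function_star_body)

lemma star_body_sublevel_1: "sublevel 1 = K"
  using star_body_eq_sublevel by (simp add: sublevel_def)

text \<open>If \<open>K\<close> were null, so would be all its dilates, and countably many of them
  cover the space because the functional is finite everywhere.\<close>

lemma star_body_measure_pos: "0 < vol K"
proof (rule ccontr)
  assume "\<not> 0 < vol K"
  then have "measure lborel (sublevel 1) = 0"
    by (simp add: star_body_sublevel_1 zero_less_measure_iff)
  \<comment> \<open>\<open>measure\<close> is also 0 on sets of infinite measure, hence the appeal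
    to finiteness.\<close>
  then have "emeasure lborel (sublevel 1) = 0"
    using emeasure_sublevel_finite[of 1] by (simp add: emeasure_eq_ennreal_measure)
  then have "sublevel (real (Suc m)) \<in> null_sets lborel" for m
    by (intro null_setsI) (simp_all add: emeasure_sublevel[of "real (Suc m)"] del: of_nat_Suc)
  then have "(\<Union>m. sublevel (real (Suc m))) \<in> null_sets lborel"
    by (intro null_sets_UN) auto
  moreover have "(\<Union>m. sublevel (real (Suc m))) = UNIV"
  proof (intro set_eqI iffI UNIV_I)
    fix x
    obtain m where "minkowski_functional K x \<le> real m"
      using real_arch_simple by blast
    then show "x \<in> (\<Union>m. sublevel (real (Suc m)))"
      by (auto simp: sublevel_def intro!: exI[of _ m])
  qed
  ultimately show False by (simp add: null_sets_def)
qed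

text \<open>By continuity the functional is bounded by some b on the unit sphere, so homogeneity
  bounds it by r b on the ball of radius r. This makes \<open>ln\<close> of the functional
  integrable over any bounded Borel set, in particular over the other body.\<close>

lemma bounded_subset_sublevel:
  assumes "bounded A"
  shows "\<exists>t>0. A \<subseteq> sublevel t"
proof -
  have cont: "continuous_on (sphere 0 1) (minkowski_functional K)"
    using K by (auto simp: symmetric_star_body_def intro: continuous_on_subset)
  have "bounded (minkowski_functional K ` sphere 0 1)"
    by (intro compact_imp_bounded compact_continuous_image cont) auto
  then obtain b where "0 < b" "\<forall>u\<in>sphere 0 1. \<bar>minkowski_functional K u\<bar> \<le> b"
    unfolding bounded_pos by auto
  then have b: "0 < b" "\<And>u. norm u = 1 \<Longrightarrow> minkowski_functional K u \<le> b"
    by (auto dest: abs_le_D1)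
  obtain r where r: "0 < r" "\<And>x. x \<in> A \<Longrightarrow> norm x \<le> r"
    using assms unfolding bounded_pos by blast
  have "minkowski_functional K x \<le> r * b" if "x \<in> A" for x
  proof (cases "x = 0")
    case True
    then have "minkowski_functional K x \<le> 0" by (simp add: minkowski_functional_le_0_iff)
    also have "0 \<le> r * b" using b r by simp
    finally show ?thesis .
  next
    case False
    then have "minkowski_functional K x = norm x * minkowski_functional K ((1 / norm x) *\<^sub>R x)"
      using scale[of "norm x" "(1 / norm x) *\<^sub>R x"] by simp
    also have "\<dots> \<le> r * b"
      using False r(1) r(2)[OF that] b(1)
      by (intro mult_mono b(2) minkowski_functional_least(1)) auto
    finally show ?thesis .
  qed
  then show ?thesis
    using b r by (intro exI[of _ "r * b"]) (auto simp: sublevel_def)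
qed

lemma integrable_ln_minkowski_functional:
  assumes "bounded A" "A \<in> sets borel"
  shows "integrable lborel (\<lambda>x. indicator A x * ln (minkowski_functional K x))"
  using bounded_subset_sublevel[OF assms(1)] integrable_ln_subset assms(2) by blast

lemma volume_le_if_average_ln_le:
  assumes L: "bounded L" "L \<in> sets borel"
    and le: "(1 / vol L) * (\<integral>x. indicator L x * ln (minkowski_functional K x) \<partial>lborel)
      \<le> (1 / vol K) * (\<integral>x. indicator K x * ln (minkowski_functional K x) \<partial>lborel)"
  shows "vol L \<le> vol K"
proof (cases "vol L = 0")
  case True
  then show ?thesis by simp
next
  case False
  then have L_pos: "0 < vol L" by (simp add: zero_less_measure_iff)
  \<comment> \<open>The dilation factor for which tK has the volume of \<open>L\<close>, as the
    bathtub inequality requires.\<close>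
  define t where "t = root DIM('a) (vol L / vol K)"
  define I where "I = (\<integral>x. indicator K x * ln (minkowski_functional K x) \<partial>lborel)"
  have t: "0 < t" "t ^ DIM('a) * vol K = vol L"
    using L_pos star_body_measure_pos by (simp_all add: t_def)
  have "t ^ DIM('a) * (I + vol K * ln t)
      = (\<integral>x. indicator (sublevel t) x * ln (minkowski_functional K x) \<partial>lborel)"
    using integral_ln_sublevel[OF t(1)] by (simp add: star_body_sublevel_1 I_def)
  also have "\<dots> \<le> (\<integral>x. indicator L x * ln (minkowski_functional K x) \<partial>lborel)"
    using t measure_sublevel[OF t(1)] emeasure_bounded_finite[OF L(1)] L
    by (intro integral_ln_sublevel_le integrable_ln_minkowski_functional)
      (auto simp: star_body_sublevel_1)
  also have "\<dots> \<le> vol L / vol K * I"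
    using le L_pos by (simp add: I_def field_simps)
  also have "\<dots> = t ^ DIM('a) * I"
    using t(2) star_body_measure_pos by (simp add: field_simps)
  \<comment> \<open>The term \<open>t ^ DIM('a) * I\<close> stands on both ends of the chain and
    cancels.\<close>
  finally have "(t ^ DIM('a) * vol K) * ln t \<le> 0"
    by (simp add: distrib_left)
  then have "ln t \<le> 0"
    using t(2) L_pos by (simp add: mult_le_0_iff)
  then have "t \<le> 1" using t(1) by simp
  then have "t ^ DIM('a) \<le> 1" using t(1) by (intro power_le_one) auto
  then show ?thesis
    using t(2) star_body_measure_pos by (metis mult_left_le_one_le less_imp_le zero_le_power t(1))
qed

end

section \<open>From inclusion of polar bodies to averages, and joint integrability\<close>

text \<open>Integrability is required only at the given direction: Fubini provides it for almost every
  direction, which suffices below.\<close>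

lemma average_ln_inner_le:
  fixes K L :: "'a::euclidean_space set"
  assumes "0 < vol K" "0 < vol L" "K \<in> sets borel" "L \<in> sets borel"
    and "emeasure lborel K < \<infinity>" "emeasure lborel L < \<infinity>"
    and sub: "polar_0_centroid_body K \<subseteq> polar_0_centroid_body L"
    and "\<xi> \<noteq> 0"
    and int: "integrable lborel (\<lambda>x. indicator K x * ln \<bar>x \<bullet> \<xi>\<bar>)"
      "integrable lborel (\<lambda>x. indicator L x * ln \<bar>x \<bullet> \<xi>\<bar>)"
  shows "(1 / vol L) * (\<integral>x. indicator L x * ln \<bar>x \<bullet> \<xi>\<bar> \<partial>lborel)
    \<le> (1 / vol K) * (\<integral>x. indicator K x * ln \<bar>x \<bullet> \<xi>\<bar> \<partial>lborel)"
proof -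
  define avg where "avg A = (1 / vol A) * (\<integral>x. indicator A x * ln \<bar>x \<bullet> \<xi>\<bar> \<partial>lborel)"
    for A :: "'a set"
  \<comment> \<open>Homogeneity of degree 1 along the ray through \<open>\<xi>\<close>, in
    exponential form.\<close>
  have norm_eq: "polar_0_centroid_norm A (s *\<^sub>R \<xi>) = exp (ln s + avg A)"
    if s: "0 < s" and A: "0 < vol A" "A \<in> sets borel" "emeasure lborel A < \<infinity>"
      "integrable lborel (\<lambda>x. indicator A x * ln \<bar>x \<bullet> \<xi>\<bar>)" for s A
  proof -
    note [measurable] = A(2)
    have i: "integrable lborel (\<lambda>x. indicator A x * ln s)"
      using A(2,3) by (intro integrable_mult_left integrable_real_indicator) auto
    have "(LINT x:A|lborel. ln \<bar>x \<bullet> (s *\<^sub>R \<xi>)\<bar>) = (\<integral>x. indicator A x * ln s + indicator A x * ln \<bar>x \<bullet> \<xi>\<bar> \<partial>lborel)"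
      unfolding set_lebesgue_integral_def
    proof (rule integral_cong_AE)
      show "AE x in lborel. indicator A x *\<^sub>R ln \<bar>x \<bullet> (s *\<^sub>R \<xi>)\<bar>
          = indicator A x * ln s + indicator A x * ln \<bar>x \<bullet> \<xi>\<bar>"
        using AE_lborel_inner_nonzero[OF \<open>\<xi> \<noteq> 0\<close>]
        by eventually_elim (use s in \<open>simp add: abs_mult ln_mult distrib_left\<close>)
    qed measurable
    also have "\<dots> = vol A * ln s + (\<integral>x. indicator A x * ln \<bar>x \<bullet> \<xi>\<bar> \<partial>lborel)"
      using A i by simp
    finally show ?thesis
      using s A \<open>\<xi> \<noteq> 0\<close> by (simp add: polar_0_centroid_norm_def avg_def field_simps)
  qed
  \<comment> \<open>This factor puts \<open>?s *\<^sub>R \<xi>\<close> on the boundary of the polar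
    body of \<open>K\<close>, where its norm is exactly 1. Membership in the polar body of
    \<open>L\<close> then reads \<open>avg L - avg K \<le> 0\<close>.\<close>
  let ?s = "exp (- avg K)"
  have "polar_0_centroid_norm K (?s *\<^sub>R \<xi>) \<le> 1"
    using assms by (subst norm_eq) auto
  then have "polar_0_centroid_norm L (?s *\<^sub>R \<xi>) \<le> 1"
    using sub by (auto simp: polar_0_centroid_body_def)
  then have "exp (ln ?s + avg L) \<le> 1"
    using assms by (subst (asm) norm_eq) auto
  then show ?thesis by (simp add: avg_def)
qed

text \<open>Absolute integrability is checked by integrating over directions first: on a bounded set
  \<open>ln \<bar>x \<bullet> \<xi>\<bar>\<close> is bounded above, so the integral of its modulus is controlled by \<open>- ln (N x)\<close>.\<close>

lemma integrable_pair_ln_inner: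
  fixes N :: "'a::euclidean_space \<Rightarrow> real"
  assumes \<mu>: "finite_measure \<mu>" "sets \<mu> = sets (restrict_space borel (sphere (0::'a) 1))"
    and rep: "\<And>x. x \<noteq> 0 \<Longrightarrow> integrable \<mu> (\<lambda>\<xi>. ln \<bar>x \<bullet> \<xi>\<bar>)"
      "\<And>x. x \<noteq> 0 \<Longrightarrow> ln (N x) = (LINT \<xi>|\<mu>. ln \<bar>x \<bullet> \<xi>\<bar>) + C"
    and A: "bounded A" "A \<in> sets borel" "integrable lborel (\<lambda>x. indicator A x * ln (N x))"
  shows "integrable (lborel \<Otimes>\<^sub>M \<mu>) (\<lambda>(x, \<xi>). indicator A x * ln \<bar>x \<bullet> \<xi>\<bar>)"
proof -
  interpret \<mu>: finite_measure \<mu> by fact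
  interpret pair_sigma_finite lborel \<mu> ..
  note [measurable] = A(2)
  have [measurable]: "(\<lambda>\<xi>. \<xi>) \<in> measurable \<mu> borel"
    using measurable_restrict_space1[OF measurable_ident_sets[OF refl], of borel "sphere 0 1"]
    by (simp add: measurable_cong_sets[OF \<mu>(2) refl])
  have sphere: "norm \<xi> = 1" if "\<xi> \<in> space \<mu>" for \<xi>
    using that sets_eq_imp_space_eq[OF \<mu>(2)] by (simp add: space_restrict_space)
  obtain r where r: "0 < r" "\<And>x. x \<in> A \<Longrightarrow> norm x \<le> r"
    using A(1) unfolding bounded_pos by blast
  \<comment> \<open>The maximum with 1 ensures \<open>0 \<le> ln R\<close>.\<close>
  define R where "R = max 1 r"
  have R: "1 \<le> R" "\<And>x. x \<in> A \<Longrightarrow> norm x \<le> R"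
    using r by (force simp: R_def)+
  \<comment> \<open>If u \<le> M and 0 \<le> M, then |u| \<le> 2M - u; here M = \<open>ln R\<close>.
    On the orthogonal hyperplane u is 0 by the convention for \<open>ln 0\<close>.\<close>
  have bound: "\<bar>ln \<bar>x \<bullet> \<xi>\<bar>\<bar> \<le> 2 * ln R - ln \<bar>x \<bullet> \<xi>\<bar>" if "x \<in> A" "\<xi> \<in> space \<mu>" for x \<xi>
  proof (cases "x \<bullet> \<xi> = 0")
    case True
    then show ?thesis using R(1) by simp
  next
    case False
    have "\<bar>x \<bullet> \<xi>\<bar> \<le> R"
      using Cauchy_Schwarz_ineq2[of x \<xi>] sphere[OF that(2)] R(2)[OF that(1)] by simp
    then have "ln \<bar>x \<bullet> \<xi>\<bar> \<le> ln R" using False R(1) by simp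
    moreover have "0 \<le> ln R" using R(1) by simp
    ultimately show ?thesis by linarith
  qed
  \<comment> \<open>For nonzero x in \<open>A\<close> this is the integral of the preceding bound
    over all directions, evaluated by the representation of \<open>ln (N x)\<close>.\<close>
  let ?h = "\<lambda>x. indicator A x * (2 * ln R * measure \<mu> (space \<mu>) + C) - indicator A x * ln (N x)"
  have h: "integrable lborel ?h"
    using A emeasure_bounded_finite[OF A(1)]
    by (intro Bochner_Integration.integrable_diff integrable_mult_left integrable_real_indicator) auto
  show ?thesis
  proof (rule Fubini_integrable)
    show "(\<lambda>(x, \<xi>). indicator A x * ln \<bar>x \<bullet> \<xi>\<bar>) \<in> borel_measurable (lborel \<Otimes>\<^sub>M \<mu>)"
      by measurable
    show "AE x in lborel. integrable \<mu> (\<lambda>\<xi>. case (x, \<xi>) of (x, \<xi>) \<Rightarrow> indicator A x * ln \<bar>x \<bullet> \<xi>\<bar>)"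
      using AE_lborel_singleton[of 0] by eventually_elim (simp add: rep(1))
    show "integrable lborel
      (\<lambda>x. \<integral>\<xi>. norm (case (x, \<xi>) of (x, \<xi>) \<Rightarrow> indicator A x * ln \<bar>x \<bullet> \<xi>\<bar>) \<partial>\<mu>)"
    proof (rule Bochner_Integration.integrable_bound[OF h])
      show "AE x in lborel. norm (\<integral>\<xi>. norm (case (x, \<xi>) of (x, \<xi>) \<Rightarrow> indicator A x * ln \<bar>x \<bullet> \<xi>\<bar>) \<partial>\<mu>)
        \<le> norm (?h x)"
        using AE_lborel_singleton[of 0]
      proof eventually_elim
        case (elim x)
        show ?case
        proof (cases "x \<in> A")
          case True
          have "(\<integral>\<xi>. \<bar>ln \<bar>x \<bullet> \<xi>\<bar>\<bar> \<partial>\<mu>) \<le> (\<integral>\<xi>. 2 * ln R - ln \<bar>x \<bullet> \<xi>\<bar> \<partial>\<mu>)"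
            using True elim rep(1)[of x] bound by (intro integral_mono) auto
          also have "\<dots> = ?h x"
            using True elim rep[of x] by simp
          finally show ?thesis using True by simp
        qed simp
      qed
    qed measurable
  qed
qed

section \<open>Integration over directions and the volume comparison\<close>

theorem theorem3p5:
  fixes K L :: "(real ^ 'n) set"
  assumes "symmetric_star_body K"
    and "symmetric_star_body L"
    and "embeds_in_L0 (minkowski_functional K)"
    and "polar_0_centroid_body K \<subseteq> polar_0_centroid_body L"
  shows "vol L \<le> vol K"
proof -
  let ?N = "minkowski_functional K"
  obtain \<mu> :: "(real ^ 'n) measure" and C where \<mu>: "finite_measure \<mu>"
      "sets \<mu> = sets (restrict_space borel (sphere 0 1))"
    and rep: "\<And>x. x \<noteq> 0 \<Longrightarrow> integrable \<mu> (\<lambda>\<xi>. ln \<bar>x \<bullet> \<xi>\<bar>)"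
      "\<And>x. x \<noteq> 0 \<Longrightarrow> ln (?N x) = (LINT \<xi>|\<mu>. ln \<bar>x \<bullet> \<xi>\<bar>) + C"
    using assms(3) unfolding embeds_in_L0_def by blast
  interpret \<mu>: finite_measure \<mu> by fact
  interpret pair_sigma_finite lborel \<mu> ..
  define F where "F A \<xi> = (\<integral>x. indicator A x * ln \<bar>x \<bullet> \<xi>\<bar> \<partial>lborel)" for A and \<xi> :: "real ^ 'n"
  have compact: "compact K" "compact L"
    using assms(1,2) by (auto simp: symmetric_star_body_def)
  then have meas: "K \<in> sets borel" "L \<in> sets borel" and bdd: "bounded K" "bounded L"
    by (auto intro: borel_compact compact_imp_bounded)
  note pos = star_body_measure_pos[OF assms(1)] star_body_measure_pos[OF assms(2)]

  \<comment> \<open>Integrating the representation of \<open>ln (?N x)\<close> over \<open>A\<close>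
    and exchanging the integrals expresses the integral of \<open>ln ?N\<close> through the
    directional integrals \<open>F A\<close>.\<close>
  have Fubini: "(AE \<xi> in \<mu>. integrable lborel (\<lambda>x. indicator A x * ln \<bar>x \<bullet> \<xi>\<bar>))"
      "integrable \<mu> (F A)"
      "(\<integral>\<xi>. F A \<xi> \<partial>\<mu>) = (\<integral>x. indicator A x * ln (?N x) \<partial>lborel) - C * vol A"
    if A: "bounded A" "A \<in> sets borel" for A
  proof -
    note ln_int = integrable_ln_minkowski_functional[OF assms(1) A]
    have int: "integrable (lborel \<Otimes>\<^sub>M \<mu>) (\<lambda>(x, \<xi>). indicator A x * ln \<bar>x \<bullet> \<xi>\<bar>)"
      using \<mu> rep A ln_int by (rule integrable_pair_ln_inner)
    show "AE \<xi> in \<mu>. integrable lborel (\<lambda>x. indicator A x * ln \<bar>x \<bullet> \<xi>\<bar>)"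
      using AE_integrable_snd[OF int] .
    show "integrable \<mu> (F A)"
      unfolding F_def using integrable_snd[OF int] .
    have "(\<integral>\<xi>. F A \<xi> \<partial>\<mu>) = (\<integral>x. (\<integral>\<xi>. indicator A x * ln \<bar>x \<bullet> \<xi>\<bar> \<partial>\<mu>) \<partial>lborel)"
      unfolding F_def by (rule Fubini_integral[OF int])
    also have "\<dots> = (\<integral>x. indicator A x * ln (?N x) - indicator A x * C \<partial>lborel)"
    proof (rule integral_cong_AE)
      show "(\<lambda>x. \<integral>\<xi>. indicator A x * ln \<bar>x \<bullet> \<xi>\<bar> \<partial>\<mu>) \<in> borel_measurable lborel"
        using integrable_fst[OF int] by (rule borel_measurable_integrable)
      show "(\<lambda>x. indicator A x * ln (?N x) - indicator A x * C) \<in> borel_measurable lborel"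
        using ln_int A(2) by (intro borel_measurable_diff borel_measurable_integrable[OF ln_int]) auto
      show "AE x in lborel. (\<integral>\<xi>. indicator A x * ln \<bar>x \<bullet> \<xi>\<bar> \<partial>\<mu>)
          = indicator A x * ln (?N x) - indicator A x * C"
        using AE_lborel_singleton[of 0] by eventually_elim (simp add: rep algebra_simps)
    qed
    also have "\<dots> = (\<integral>x. indicator A x * ln (?N x) \<partial>lborel) - C * vol A"
      using ln_int A emeasure_bounded_finite[OF A(1)]
      by (subst Bochner_Integration.integral_diff) (auto intro!: integrable_mult_left integrable_real_indicator)
    finally show "(\<integral>\<xi>. F A \<xi> \<partial>\<mu>) = (\<integral>x. indicator A x * ln (?N x) \<partial>lborel) - C * vol A" .
  qed
  note FK = Fubini[OF bdd(1) meas(1)] and FL = Fubini[OF bdd(2) meas(2)]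

  have "(\<integral>\<xi>. (1 / vol L) * F L \<xi> \<partial>\<mu>) \<le> (\<integral>\<xi>. (1 / vol K) * F K \<xi> \<partial>\<mu>)"
  proof (rule integral_mono_AE)
    show "AE \<xi> in \<mu>. (1 / vol L) * F L \<xi> \<le> (1 / vol K) * F K \<xi>"
      using FK(1) FL(1) AE_space
    proof eventually_elim
      case (elim \<xi>)
      \<comment> \<open>\<open>\<mu>\<close> lives on the unit sphere, which does not contain the
        origin.\<close>
      have "\<xi> \<noteq> 0"
        using elim(3) sets_eq_imp_space_eq[OF \<mu>(2)] by (auto simp: space_restrict_space)
      then show ?case
        unfolding F_def using pos meas bdd elim assms(4)
        by (intro average_ln_inner_le emeasure_bounded_finite)
    qed
  qed (use FK(2) FL(2) in auto)
  \<comment> \<open>Dividing by the volumes turns \<open>C * vol L\<close> and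
    \<open>C * vol K\<close> into the same constant \<open>C\<close>, which cancels.\<close>
  then have "(1 / vol L) * (\<integral>x. indicator L x * ln (?N x) \<partial>lborel)
      \<le> (1 / vol K) * (\<integral>x. indicator K x * ln (?N x) \<partial>lborel)"
    using pos by (simp add: FK(3) FL(3) diff_divide_distrib)
  then show ?thesis
    by (rule volume_le_if_average_ln_le[OF assms(1) bdd(2) meas(2)])
qed

end
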